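(* Let $b\in \mathbb{R}\setminus \mathbb{Z}$. For every integer $k\geq 2$, there exists a facet (and therefore an extreme valid function) $\pi:\mathbb{R}\to\mathbb{R}_+$ for $I_b$ that is piecewise linear with $k$ slopes.
   Context: Let $\mathbb{R}_+$ and $\mathbb{Z}_+$ denote the nonnegative reals and integers. For $b\in\mathbb{R}\setminus\mathbb{Z}$, the (one-dimensional) infinite group relaxation $I_b$ is the set of functions $y:\mathbb{R}\to\mathbb{Z}_+$ with finite support satisfying $\sum_{r\in\mathbb{R}} r\,y(r)\in b+\mathbb{Z}$. A function $\pi:\mathbb{R}\to\mathbb{R}_+$ is valid for $I_b$ if $\sum_{r\in\mathbb{R}}\pi(r)y(r)\ge 1$ for every $y\in I_b$. A valid function $\pi$ is extreme if $\pi=\pi_1=\pi_2$ for every pair of valid functions $\pi_1,\pi_2$ with $\pi=\frac{\pi_1+\pi_2}{2}$. For a valid function $\pi$ let $P(\pi):=\{y\in I_b: \sum_{r\in\mathbb{R}}\pi(r)y(r)=1\}$. A valid function $\pi$ is a facet if for every valid function $\pi'$, $P(\pi)\subseteq P(\pi')$ implies $\pi=\pi'$. A regular polyhedral complex in $\mathbb{R}^n$ is a collection of polyhedra $P_j$, $j\in J$, such that (1) $\mathbb{R}^n=\bigcup_{j\in J}P_j$, (2) for any $i,j\in J$, $P_i\cap P_j$ is a common face of $P_i$ and $P_j$ and also belongs to the collection, (3) any bounded subset of $\mathbb{R}^n$ intersects only finitely many polyhedra of the collection. A function $\theta:\mathbb{R}^n\to\mathbb{R}$ is piecewise linear if there is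 a regular polyhedral complex in $\mathbb{R}^n$ such that $\theta$ is affine over the interior of each polyhedron of the complex (discontinuities are allowed); here $n=1$. A piecewise linear function has $k$ slopes if its gradient, where it exists, takes exactly $k$ distinct values. *)

theory Defs
  imports "HOL-Analysis.Analysis"
begin

definition support :: "(real \<Rightarrow> nat) \<Rightarrow> real set" where
  "support y = {r. y r \<noteq> 0}"

definition group_relaxation :: "real \<Rightarrow> (real \<Rightarrow> nat) set" where
  "group_relaxation b =
     {y. finite (support y) \<and> (\<Sum>r\<in>support y. r * real (y r)) \<in> (\<lambda>z. b + z) ` \<int>}"

definition valid_function :: "real \<Rightarrow> (real \<Rightarrow> real) \<Rightarrow> bool" where
  "valid_function b \<pi> \<longleftrightarrow>
     (\<forall>r. 0 \<le> \<pi> r) \<and>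
     (\<forall>y\<in>group_relaxation b. (\<Sum>r\<in>support y. \<pi> r * real (y r)) \<ge> 1)"

definition extreme_function :: "real \<Rightarrow> (real \<Rightarrow> real) \<Rightarrow> bool" where
  "extreme_function b \<pi> \<longleftrightarrow>
     valid_function b \<pi> \<and>
     (\<forall>\<pi>1 \<pi>2. valid_function b \<pi>1 \<and> valid_function b \<pi>2 \<and>
        (\<forall>r. \<pi> r = (\<pi>1 r + \<pi>2 r) / 2) \<longrightarrow> \<pi> = \<pi>1 \<and> \<pi>1 = \<pi>2)"

definition tight_solutions :: "real \<Rightarrow> (real \<Rightarrow> real) \<Rightarrow> (real \<Rightarrow> nat) set" where
  "tight_solutions b \<pi> =
     {y \<in> group_relaxation b. (\<Sum>r\<in>support y. \<pi> r * real (y r)) = 1}"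

definition facet_function :: "real \<Rightarrow> (real \<Rightarrow> real) \<Rightarrow> bool" where
  "facet_function b \<pi> \<longleftrightarrow>
     valid_function b \<pi> \<and>
     (\<forall>\<pi>'. valid_function b \<pi>' \<and> tight_solutions b \<pi> \<subseteq> tight_solutions b \<pi>' \<longrightarrow> \<pi> = \<pi>')"

text \<open>The empty set counts both as a polyhedron and as a face, so disjoint cells are
  allowed provided the empty set belongs to the collection.\<close>

definition regular_polyhedral_complex :: "'a::euclidean_space set set \<Rightarrow> bool" where
  "regular_polyhedral_complex \<C> \<longleftrightarrow>
     (\<forall>P\<in>\<C>. polyhedron P) \<and>
     \<Union>\<C> = UNIV \<and>
     (\<forall>P\<in>\<C>. \<forall>Q\<in>\<C>. (P \<inter> Q) face_of P \<and> (P \<inter> Q) face_of Q \<and> P \<inter> Q \<in> \<C>) \<and>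
     (\<forall>B. bounded B \<longrightarrow> finite {P\<in>\<C>. P \<inter> B \<noteq> {}})"

definition affine_over :: "'a::euclidean_space set \<Rightarrow> ('a \<Rightarrow> real) \<Rightarrow> bool" where
  "affine_over S \<theta> \<longleftrightarrow> (\<exists>a c. \<forall>x\<in>S. \<theta> x = a \<bullet> x + c)"

text \<open>Only the interiors of the cells are constrained, so discontinuities on their
  boundaries are allowed. In dimension one, replacing the interior by the relative
  interior would make no difference.\<close>

definition piecewise_linear :: "('a::euclidean_space \<Rightarrow> real) \<Rightarrow> bool" where
  "piecewise_linear \<theta> \<longleftrightarrow>
     (\<exists>\<C>. regular_polyhedral_complex \<C> \<and> (\<forall>P\<in>\<C>. affine_over (interior P) \<theta>))"

definition has_slopes :: "('a::euclidean_space \<Rightarrow> real) \<Rightarrow> nat \<Rightarrow> bool" where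
  "has_slopes \<theta> k \<longleftrightarrow>
     finite {g. \<exists>x. GDERIV \<theta> x :> g} \<and> card {g. \<exists>x. GDERIV \<theta> x :> g} = k"

end

theory Submission
  imports Defs "HOL-Library.Multiset"
begin

text \<open>
  After an integer shift and possibly the reflection \<open>x \<mapsto> - x\<close> we may assume \<open>0 < b \<le> 1/2\<close>.
  The substitution \<open>G x = (1 - b) * \<pi> x + x\<close> preserves subadditivity and additivity relations and
  turns \<open>\<pi>\<close> into a nondecreasing function with \<open>G (x + 1) = G x + 1\<close> and \<open>G x + G (b - x) = 1\<close>
  that is constant on \<open>[b, 1]\<close>. On \<open>[0, b]\<close>, scaled to \<open>[0, 1]\<close>, take
  \<open>G t = max\<^sub>j (min (2 ^ j * t) (1 / (2 * 4 ^ j)))\<close>, \<open>j \<le> k - 2\<close>, for \<open>t \<le> 1/2\<close>, and extend by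
  symmetry; the positive slopes are \<open>1, 2, \<dots>, 2 ^ (k - 2)\<close>. The condition \<open>b \<le> 1/2\<close> reduces
  subadditivity of \<open>G\<close> to subadditivity on \<open>[0, b]\<close>.

  If every solution tight for \<open>\<pi>\<close> is tight for a valid \<open>\<rho>\<close>, then \<open>\<rho>\<close> inherits periodicity, symmetry
  and all additivity relations of \<open>\<pi>\<close> (use the solutions supported on \<open>x, y, b - x - y\<close>). An
  interval lemma makes \<open>\<rho>\<close> affine on each piece. Consecutive sloped pieces are linear through the
  origin and separated by flats, on which the transform of \<open>\<rho>\<close> is constant too; this links all the
  slopes, and the value \<open>1/2\<close> at \<open>b/2\<close> fixes the common factor.
\<close>

subsection \<open>Additivity on an interval\<close>

lemma interval_additive_linear:
  fixes g :: "real \<Rightarrow> real" and a h M x :: real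
  assumes "0 \<le> a" "4 * a \<le> h" "0 < h"
    and add: "\<And>x y. a \<le> x \<Longrightarrow> a \<le> y \<Longrightarrow> x + y \<le> h \<Longrightarrow> g (x + y) = g x + g y"
    and low: "\<And>x. a \<le> x \<Longrightarrow> x \<le> h \<Longrightarrow> M \<le> g x"
    and x: "a \<le> x" "x \<le> h"
  shows "g x = g h / h * x"
proof -
  define p where "p = (\<lambda>x. g x - g h / h * x)"
  define K where "K = \<bar>M\<bar> + \<bar>g h\<bar>"
  have padd: "p (x + y) = p x + p y" if "a \<le> x" "a \<le> y" "x + y \<le> h" for x y
    using add[OF that] by (simp add: p_def algebra_simps add_divide_distrib)
  have ph: "p h = 0" using assms(3) by (simp add: p_def)
  have ph2: "p (h/2) = 0" using padd[of "h/2" "h/2"] assms(1-3) ph by simp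
  have plow: "- K \<le> p x" if "a \<le> x" "x \<le> h" for x
  proof -
    have "0 \<le> x / h" "x / h \<le> 1" using that assms(1-3) by auto
    then have "\<bar>g h\<bar> * (x / h) \<le> \<bar>g h\<bar> * 1" "g h * (x / h) \<le> \<bar>g h\<bar> * (x / h)"
      by (intro mult_left_mono mult_right_mono; simp)+
    then show ?thesis using low[OF that] by (auto simp: p_def K_def)
  qed
  have refl: "p (h - x) = - p x" if "a \<le> x" "x \<le> h - a" for x
    using padd[of x "h - x"] that ph by simp
  \<comment> \<open>A bound on the lower half reaches the points near \<open>h/2\<close> by
    reflection and the remaining ones by a shift through \<open>h/2\<close>;
    \<open>4 * a \<le> h\<close> keeps the reflected points at or above \<open>a\<close>.\<close>
  have spread: "\<bar>p x\<bar> \<le> B"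
    if half: "\<And>x. a \<le> x \<Longrightarrow> x \<le> h/2 \<Longrightarrow> \<bar>p x\<bar> \<le> B" and x: "a \<le> x" "x \<le> h" for B x
  proof -
    consider "x \<le> h/2" | "h/2 \<le> x" "x \<le> h/2 + a" | "h/2 + a \<le> x" by linarith
    then show ?thesis
    proof cases
      case 1 then show ?thesis using half x by simp
    next
      case 2 then show ?thesis using half[of "h - x"] refl[of x] x assms(1,2) by simp
    next
      case 3 then show ?thesis
        using half[of "x - h/2"] padd[of "x - h/2" "h/2"] ph2 x assms(1,2) by simp
    qed
  qed
  \<comment> \<open>On the lower half \<open>p x = p (2 * x) / 2\<close>, so each round gains a
    factor 2 there, and \<open>spread\<close> restores the whole interval.\<close>
  have bound: "\<bar>p x\<bar> \<le> K / 2 ^ n" if "a \<le> x" "x \<le> h" for x n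
    using that
  proof (induction n arbitrary: x)
    case 0
    show ?case
    proof (rule spread[OF _ 0])
      fix x assume x: "a \<le> x" "x \<le> h/2"
      then show "\<bar>p x\<bar> \<le> K / 2 ^ 0"
        using plow[of x] plow[of "h - x"] refl[of x] assms(1,2) by simp
    qed
  next
    case (Suc n)
    show ?case
    proof (rule spread[OF _ Suc.prems])
      fix x assume x: "a \<le> x" "x \<le> h/2"
      then show "\<bar>p x\<bar> \<le> K / 2 ^ Suc n"
        using Suc.IH[of "2*x"] padd[of x x] assms(1) by simp
    qed
  qed
  have "p x = 0"
  proof (rule ccontr)
    assume "p x \<noteq> 0"
    then obtain n where "K / \<bar>p x\<bar> < 2 ^ n" using real_arch_pow[of 2 "K / \<bar>p x\<bar>"] by auto
    then have "K / 2 ^ n < \<bar>p x\<bar>" using \<open>p x \<noteq> 0\<close> by (simp add: field_simps)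
    then show False using bound[OF x, of n] by simp
  qed
  then show ?thesis by (simp add: p_def)
qed

subsection \<open>A criterion for facets\<close>

lemma support_count: "support (count M) = set_mset M"
  by (auto simp: support_def)

lemma sum_support_count:
  "(\<Sum>r\<in>support (count M). g r * real (count M r)) = (\<Sum>r\<in>#M. g r)"
proof -
  \<comment> \<open>The index set is a fixed finite superset of the support, so it does not change
    when an element is added.\<close>
  have "(\<Sum>r\<in>A. g r * real (count M r)) = (\<Sum>r\<in>#M. g r)"
    if "finite A" "set_mset M \<subseteq> A" for A
    using that(2)
  proof (induction M)
    case (add x M)
    have "(\<Sum>r\<in>A. g r * real (count (add_mset x M) r))
        = (\<Sum>r\<in>A. g r * real (count M r) + (if r = x then g r else 0))"
      by (intro sum.cong) (auto simp: algebra_simps)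
    also have "\<dots> = (\<Sum>r\<in>#add_mset x M. g r)"
      using add that(1) by (simp add: sum.distrib)
    finally show ?case .
  qed simp
  then show ?thesis by (simp add: support_count)
qed

text \<open>A finitely supported function into the naturals is the count of a multiset. Solutions
  thus become multisets, which can be written down explicitly and treated by induction.\<close>

lemma group_relaxation_eq_count:
  "group_relaxation b = count ` {M. \<Sum>\<^sub># M - b \<in> \<int>}"
proof -
  have shift: "x \<in> (\<lambda>z. b + z) ` \<int> \<longleftrightarrow> x - b \<in> \<int>" for x
    by (auto intro: image_eqI[of _ _ "x - b"])
  have sum: "(\<Sum>r\<in>support (count M). r * real (count M r)) = \<Sum>\<^sub># M" for M :: "real multiset"
    using sum_support_count[of "\<lambda>r. r"] by simp
  show ?thesis
  proof (intro equalityI subsetI)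
    fix y assume y: "y \<in> group_relaxation b"
    then have "finite {r. 0 < y r}" by (simp add: group_relaxation_def support_def)
    then have "y = count (Abs_multiset y)" by (simp add: Abs_multiset_inverse)
    then show "y \<in> count ` {M. \<Sum>\<^sub># M - b \<in> \<int>}"
      using y sum[of "Abs_multiset y"] by (auto simp: group_relaxation_def shift)
  qed (auto simp: group_relaxation_def shift support_count sum[unfolded support_count])
qed

lemma valid_function_iff_mset:
  "valid_function b \<pi> \<longleftrightarrow>
     (\<forall>r. 0 \<le> \<pi> r) \<and> (\<forall>M. \<Sum>\<^sub># M - b \<in> \<int> \<longrightarrow> 1 \<le> (\<Sum>r\<in>#M. \<pi> r))"
  by (auto simp: valid_function_def group_relaxation_eq_count sum_support_count)

lemma tight_solutions_subset_iff:
  "tight_solutions b \<pi> \<subseteq> tight_solutions b \<rho> \<longleftrightarrow>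
     (\<forall>M. \<Sum>\<^sub># M - b \<in> \<int> \<longrightarrow> (\<Sum>r\<in>#M. \<pi> r) = 1 \<longrightarrow> (\<Sum>r\<in>#M. \<rho> r) = 1)"
  by (auto simp: tight_solutions_def group_relaxation_eq_count sum_support_count)

text \<open>On a solution tight for \<open>\<pi>\<close> the values of \<open>\<pi>1\<close> and
  \<open>\<pi>2\<close> are at least 1 and average to 1, so both are tight, and the facet property
  applies to each.\<close>

lemma facet_imp_extreme:
  assumes "facet_function b \<pi>"
  shows "extreme_function b \<pi>"
  unfolding extreme_function_def
proof (intro conjI allI impI; (elim conjE)?)
  show val: "valid_function b \<pi>" using assms by (simp add: facet_function_def)
  fix \<pi>1 \<pi>2
  assume v: "valid_function b \<pi>1" "valid_function b \<pi>2"
    and avg: "\<forall>r. \<pi> r = (\<pi>1 r + \<pi>2 r) / 2"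
  have sum: "(\<Sum>r\<in>#M. \<pi> r) = ((\<Sum>r\<in>#M. \<pi>1 r) + (\<Sum>r\<in>#M. \<pi>2 r)) / 2" for M
    using avg by (induction M) (auto simp: field_simps)
  have "(\<Sum>r\<in>#M. \<pi>1 r) = 1 \<and> (\<Sum>r\<in>#M. \<pi>2 r) = 1"
    if M: "\<Sum>\<^sub># M - b \<in> \<int>" "(\<Sum>r\<in>#M. \<pi> r) = 1" for M
  proof -
    have "1 \<le> (\<Sum>r\<in>#M. \<pi>1 r)" "1 \<le> (\<Sum>r\<in>#M. \<pi>2 r)"
      using v M(1) by (auto simp: valid_function_iff_mset)
    then show ?thesis using sum[of M] M(2) by simp
  qed
  then have "tight_solutions b \<pi> \<subseteq> tight_solutions b \<pi>1" "tight_solutions b \<pi> \<subseteq> tight_solutions b \<pi>2"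
    by (auto simp: tight_solutions_subset_iff)
  then have "\<pi> = \<pi>1" "\<pi> = \<pi>2" using assms v by (auto simp: facet_function_def)
  then show "\<pi> = \<pi>1" "\<pi>1 = \<pi>2" by simp_all
qed

text \<open>Together with subadditivity these are the classical conditions for a minimal valid
  function. Subadditivity is kept apart because competitors are only asked to satisfy the
  rest.\<close>

definition symmetric_periodic :: "real \<Rightarrow> (real \<Rightarrow> real) \<Rightarrow> bool" where
  "symmetric_periodic b \<pi> \<longleftrightarrow>
     (\<forall>x. 0 \<le> \<pi> x) \<and> \<pi> 0 = 0 \<and> (\<forall>x. \<pi> (x + 1) = \<pi> x) \<and> (\<forall>x. \<pi> x + \<pi> (b - x) = 1)"

text \<open>The uniqueness half of the facet property, freed from solutions: the additivity
  relations of \<open>\<pi>\<close> stand in for its tight solutions.\<close>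

definition additively_rigid :: "real \<Rightarrow> (real \<Rightarrow> real) \<Rightarrow> bool" where
  "additively_rigid b \<pi> \<longleftrightarrow>
     (\<forall>\<rho>. symmetric_periodic b \<rho> \<longrightarrow>
        (\<forall>x y. \<pi> (x + y) = \<pi> x + \<pi> y \<longrightarrow> \<rho> (x + y) = \<rho> x + \<rho> y) \<longrightarrow> \<rho> = \<pi>)"

lemma periodic_add_Ints:
  fixes f :: "real \<Rightarrow> real"
  assumes per: "\<And>x. f (x + 1) = f x" and "z \<in> \<int>"
  shows "f (x + z) = f x"
proof -
  have "f (x + of_int n) = f x" for n
  proof (induction n rule: int_induct[where k = 0])
    case (step1 i) then show ?case using per[of "x + of_int i"] by (simp add: algebra_simps)
  next
    case (step2 i) then show ?case using per[of "x + of_int (i - 1)"] by (simp add: algebra_simps)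
  qed simp
  then show ?thesis using assms(2) by (auto elim: Ints_cases)
qed

text \<open>Subadditivity bounds the value of a solution below by \<open>\<pi>\<close> of its sum,
  which is \<open>\<pi> b = 1\<close> by periodicity. For a competitor \<open>\<rho>\<close>, the
  tight solutions \<open>{#b#}\<close>, \<open>{#x, b - x#}\<close> and
  \<open>{#x + 1, b - x#}\<close> force \<open>\<rho> 0 = 0\<close>, symmetry and
  periodicity.\<close>

lemma facet_functionI:
  assumes sp: "symmetric_periodic b \<pi>"
    and subadd: "\<And>x y. \<pi> (x + y) \<le> \<pi> x + \<pi> y"
    and rigid: "additively_rigid b \<pi>"
  shows "facet_function b \<pi>"
proof -
  have pos: "0 \<le> \<pi> x" and zero: "\<pi> 0 = 0" and per: "\<pi> (x + 1) = \<pi> x"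
    and sym: "\<pi> x + \<pi> (b - x) = 1" for x
    using sp by (auto simp: symmetric_periodic_def)
  have pb: "\<pi> b = 1" using sym[of 0] zero by simp
  have msub: "\<pi> (\<Sum>\<^sub># M) \<le> (\<Sum>r\<in>#M. \<pi> r)" for M
  proof (induction M)
    case (add x M) then show ?case using subadd[of x "\<Sum>\<^sub># M"] by simp
  qed (simp add: zero)
  have valid: "valid_function b \<pi>"
    unfolding valid_function_iff_mset
  proof (intro conjI allI impI pos)
    fix M assume "\<Sum>\<^sub># M - b \<in> \<int>"
    then have "\<pi> (\<Sum>\<^sub># M) = 1"
      using periodic_add_Ints[of \<pi> "\<Sum>\<^sub># M - b" b] per pb by simp
    then show "1 \<le> (\<Sum>r\<in>#M. \<pi> r)" using msub[of M] by simp
  qed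
  have "\<rho> = \<pi>" if v: "valid_function b \<rho>"
    and tight: "tight_solutions b \<pi> \<subseteq> tight_solutions b \<rho>" for \<rho>
  proof -
    have T: "(\<Sum>r\<in>#M. \<rho> r) = 1" if "\<Sum>\<^sub># M - b \<in> \<int>" "(\<Sum>r\<in>#M. \<pi> r) = 1" for M
      using tight that by (auto simp: tight_solutions_subset_iff)
    have rsym: "\<rho> x + \<rho> (b - x) = 1" for x
      using T[of "{#x, b - x#}"] sym[of x] by simp
    have "\<rho> b = 1" using T[of "{#b#}"] pb by simp
    then have r0: "\<rho> 0 = 0" using rsym[of 0] by simp
    have "\<rho> (x + 1) = \<rho> x" for x
      using T[of "{#x + 1, b - x#}"] sym[of x] rsym[of x] per[of x] by simp
    then have "symmetric_periodic b \<rho>"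
      using v rsym r0 by (auto simp: symmetric_periodic_def valid_function_def)
    \<comment> \<open>Symmetry at \<open>x + y\<close> turns additivity of \<open>\<pi>\<close> into
      tightness of the three-element solution; symmetry of \<open>\<rho>\<close> translates
      tightness back.\<close>
    moreover have "\<rho> (x + y) = \<rho> x + \<rho> y" if "\<pi> (x + y) = \<pi> x + \<pi> y" for x y
      using T[of "{#x, y, b - (x + y)#}"] sym[of "x + y"] rsym[of "x + y"] that by simp
    ultimately show ?thesis using rigid by (auto simp: additively_rigid_def)
  qed
  then show ?thesis using valid by (auto simp: facet_function_def)
qed

section \<open>Integer shifts and reflection of \<open>b\<close>\<close>

lemma symmetric_periodic_cong_Ints:
  assumes "b - c \<in> \<int>" "symmetric_periodic c \<pi>"
  shows "symmetric_periodic b \<pi>"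
proof -
  have "\<pi> (b - x) = \<pi> (c - x)" for x
    using periodic_add_Ints[of \<pi> "b - c" "c - x"] assms by (simp add: symmetric_periodic_def)
  then show ?thesis using assms(2) by (simp add: symmetric_periodic_def)
qed

lemma additively_rigid_cong_Ints:
  assumes "b - c \<in> \<int>" "additively_rigid c \<pi>"
  shows "additively_rigid b \<pi>"
  using assms symmetric_periodic_cong_Ints[of c b] Ints_minus[OF assms(1)]
  by (auto simp: additively_rigid_def)

lemma symmetric_periodic_reflect:
  assumes "symmetric_periodic b \<pi>"
  shows "symmetric_periodic (- b) (\<lambda>x. \<pi> (- x))"
  unfolding symmetric_periodic_def
proof (intro conjI allI)
  fix x
  show "\<pi> (- (x + 1)) = \<pi> (- x)"
    using assms unfolding symmetric_periodic_def
    by (metis add.inverse_distrib_swap add.commute add_diff_cancel_left' diff_add_cancel uminus_add_conv_diff)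
  show "\<pi> (- x) + \<pi> (- (- b - x)) = 1"
    using assms unfolding symmetric_periodic_def
    by (metis add.commute diff_minus_eq_add minus_diff_eq)
qed (use assms in \<open>auto simp: symmetric_periodic_def\<close>)

text \<open>Reflection is an involution, so a competitor of the reflected function reflects to a
  competitor of \<open>\<pi>\<close>.\<close>

lemma additively_rigid_reflect:
  assumes "additively_rigid b \<pi>"
  shows "additively_rigid (- b) (\<lambda>x. \<pi> (- x))"
  unfolding additively_rigid_def
proof (intro allI impI)
  fix \<rho> assume sp: "symmetric_periodic (- b) \<rho>"
    and add: "\<forall>x y. \<pi> (- (x + y)) = \<pi> (- x) + \<pi> (- y) \<longrightarrow> \<rho> (x + y) = \<rho> x + \<rho> y"
  have "(\<lambda>x. \<rho> (- x)) = \<pi>"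
  proof -
    have "\<rho> (- (x + y)) = \<rho> (- x) + \<rho> (- y)" if "\<pi> (x + y) = \<pi> x + \<pi> y" for x y
      using add[rule_format, of "- x" "- y"] that by (simp add: add.commute)
    then show ?thesis
      using assms symmetric_periodic_reflect[OF sp] by (auto simp: additively_rigid_def)
  qed
  then show "\<rho> = (\<lambda>x. \<pi> (- x))" by (metis minus_minus)
qed

subsection \<open>The staircase function and its rigidity\<close>

text \<open>The self-similar form of \<open>max\<^sub>j (min (2 ^ j * t) (1 / (2 * 4 ^ j)))\<close>, \<open>j \<le> m\<close>, cut off at 0.\<close>

primrec stair :: "nat \<Rightarrow> real \<Rightarrow> real" where
  "stair 0 t = max 0 (min t (1/2))"
| "stair (Suc m) t = max (max 0 (min t (1/2))) (stair m (8 * t) / 4)"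

lemma stair_nonneg: "0 \<le> stair m t"
  by (cases m) auto

lemma stair_le_half: "stair m t \<le> 1/2"
proof (induction m arbitrary: t)
  case (Suc m)
  have "stair m (8 * t) / 4 \<le> 1/2" using Suc.IH[of "8 * t"] by linarith
  then show ?case by simp
qed simp

lemma stair_0_le: "stair 0 t \<le> stair m t"
  by (cases m) auto

lemma stair_ge: "t \<le> 1/2 \<Longrightarrow> t \<le> stair m t"
  using stair_0_le[of t m] by simp

lemma stair_mono: "s \<le> t \<Longrightarrow> stair m s \<le> stair m t"
proof (induction m arbitrary: s t)
  case (Suc m)
  then have "stair m (8 * s) / 4 \<le> stair m (8 * t) / 4"
    by (intro divide_right_mono Suc.IH) auto
  then show ?case unfolding stair.simps using Suc.prems by (intro max.mono min.mono) auto
qed auto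

lemma stair_nonpos: "t \<le> 0 \<Longrightarrow> stair m t = 0"
  by (induction m arbitrary: t) auto

text \<open>Divided by 4, the inner copy is at most 1/8, so the outer branch dominates from 1/8
  on.\<close>

lemma stair_Suc_large: "1/8 \<le> t \<Longrightarrow> stair (Suc m) t = stair 0 t"
  using stair_le_half[of m "8 * t"] by auto

text \<open>For \<open>0 \<le> t\<close> the lowest branch of the inner copy is, after rescaling,
  \<open>min (2 * t) (1/8)\<close>, which is at least \<open>t\<close> up to 1/8.\<close>

lemma stair_Suc_small: "t \<le> 1/8 \<Longrightarrow> stair (Suc m) t = stair m (8 * t) / 4"
  using stair_0_le[of "8 * t" m] by auto

lemma stair_half: "1/2 \<le> t \<Longrightarrow> stair m t = 1/2"
  by (cases m) (auto simp: stair_Suc_large simp del: stair.simps(2))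

text \<open>Up to 1/8 rescaling reduces to the previous level. Beyond 1/8 the value at
  \<open>s + t\<close> is that of \<open>stair 0\<close>, which is subadditive and lies below the
  staircase.\<close>

lemma stair_subadditive:
  "0 \<le> s \<Longrightarrow> 0 \<le> t \<Longrightarrow> stair m (s + t) \<le> stair m s + stair m t"
proof (induction m arbitrary: s t)
  case (Suc m)
  show ?case
  proof (cases "s + t \<le> 1/8")
    case True
    then show ?thesis
      using Suc.IH[of "8 * s" "8 * t"] Suc.prems
      by (simp add: stair_Suc_small algebra_simps del: stair.simps)
  next
    case False
    have "stair (Suc m) (s + t) = stair 0 (s + t)" using False by (intro stair_Suc_large) auto
    also have "\<dots> \<le> stair 0 s + stair 0 t" using Suc.prems by auto
    also have "\<dots> \<le> stair (Suc m) s + stair (Suc m) t"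
      by (intro add_mono stair_0_le)
    finally show ?thesis .
  qed
qed auto

text \<open>On [1/8, 1/2] the staircase is the identity, so the interval lemma makes
  \<open>g\<close> linear there; on [0, 1/8] the induction hypothesis applies to the rescaled
  \<open>g\<close>. The two descriptions meet at 1/8, which equates their factors.\<close>

lemma stair_rigid:
  fixes g :: "real \<Rightarrow> real"
  assumes add: "\<And>s t. 0 \<le> s \<Longrightarrow> 0 \<le> t \<Longrightarrow> s + t \<le> 1/2 \<Longrightarrow>
      stair m (s + t) = stair m s + stair m t \<Longrightarrow> g (s + t) = g s + g t"
    and const: "\<And>s t. 0 \<le> s \<Longrightarrow> s \<le> t \<Longrightarrow> t \<le> 1/2 \<Longrightarrow> stair m s = stair m t \<Longrightarrow> g s = g t"
    and low: "\<And>t. 0 \<le> t \<Longrightarrow> t \<le> 1/2 \<Longrightarrow> 0 \<le> g t"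
  shows "\<exists>\<alpha>. \<forall>t\<in>{0..1/2}. g t = \<alpha> * stair m t"
  using assms
proof (induction m arbitrary: g)
  case 0
  have lin: "g t = g (1/2) / (1/2) * t" if "0 \<le> t" "t \<le> 1/2" for t
  proof (rule interval_additive_linear[where a = 0 and M = 0])
    show "g (x + y) = g x + g y" if "0 \<le> x" "0 \<le> y" "x + y \<le> 1/2" for x y
      using that by (intro "0.prems"(1)) simp_all
  qed (use that "0.prems"(3) in simp_all)
  show ?case
  proof (intro exI[of _ "2 * g (1/2)"] ballI)
    fix t :: real assume "t \<in> {0..1/2}"
    then show "g t = 2 * g (1/2) * stair 0 t" using lin[of t] by simp
  qed
next
  case (Suc m)
  note [simp del] = stair.simps(2)
  \<comment> \<open>With \<open>h = 1/2\<close> the condition \<open>4 * a \<le> h\<close> of the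
    interval lemma holds with equality.\<close>
  have lin: "g t = g (1/2) / (1/2) * t" if "1/8 \<le> t" "t \<le> 1/2" for t
  proof (rule interval_additive_linear[where a = "1/8" and M = 0])
    show "g (x + y) = g x + g y" if "1/8 \<le> x" "1/8 \<le> y" "x + y \<le> 1/2" for x y
      using that by (intro Suc.prems(1)) (simp_all add: stair_Suc_large)
  qed (use that Suc.prems(3) in simp_all)
  have "\<exists>\<alpha>. \<forall>t\<in>{0..1/2}. g (t/8) = \<alpha> * stair m t"
  proof (rule Suc.IH)
    fix s t :: real assume "0 \<le> s" "0 \<le> t" "s + t \<le> 1/2" "stair m (s + t) = stair m s + stair m t"
    then show "g ((s + t)/8) = g (s/8) + g (t/8)"
      using Suc.prems(1)[of "s/8" "t/8"] by (simp add: stair_Suc_small add_divide_distrib)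
  next
    fix s t :: real assume "0 \<le> s" "s \<le> t" "t \<le> 1/2" "stair m s = stair m t"
    then show "g (s/8) = g (t/8)"
      using Suc.prems(2)[of "s/8" "t/8"] by (simp add: stair_Suc_small)
  qed (use Suc.prems(3) in auto)
  then obtain \<alpha> where \<alpha>: "\<And>t. 0 \<le> t \<Longrightarrow> t \<le> 1/2 \<Longrightarrow> g (t/8) = \<alpha> * stair m t"
    by (meson atLeastAtMost_iff)
  have small: "g t = 4 * \<alpha> * stair (Suc m) t" if t: "0 \<le> t" "t \<le> 1/8" for t
  proof (cases "t \<le> 1/16")
    case True
    then show ?thesis using \<alpha>[of "8 * t"] t by (simp add: stair_Suc_small)
  next
    \<comment> \<open>Here \<open>t\<close> lies on the flat from 1/16 to 1/8, beyond the range of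
      the rescaled induction hypothesis; constancy on flats carries the value over from
      1/16.\<close>
    case False
    then have "stair m (8 * t) = 1/2" "stair m (1/2) = 1/2"
      using stair_half[of "8 * t" m] stair_half[of "1/2" m] by auto
    moreover have "g (1/16) = g t"
      using False t calculation by (intro Suc.prems(2)) (auto simp: stair_Suc_small)
    ultimately show ?thesis using \<alpha>[of "1/2"] t by (simp add: stair_Suc_small)
  qed
  have "stair (Suc m) (1/8) = 1/8" using stair_Suc_large[of "1/8" m] by simp
  then have "g (1/2) = 2 * \<alpha>" using small[of "1/8"] lin[of "1/8"] by simp
  have large: "g t = 4 * \<alpha> * stair (Suc m) t" if "1/8 \<le> t" "t \<le> 1/2" for t
    using lin[OF that] \<open>g (1/2) = 2 * \<alpha>\<close> that by (simp add: stair_Suc_large)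
  show ?case
  proof (intro exI[of _ "4 * \<alpha>"] ballI)
    fix t :: real assume "t \<in> {0..1/2}"
    then show "g t = 4 * \<alpha> * stair (Suc m) t"
      using small[of t] large[of t] by (cases "t \<le> 1/8") auto
  qed
qed

section \<open>The symmetric extension of the staircase\<close>

definition ramp :: "nat \<Rightarrow> real \<Rightarrow> real" where
  "ramp m t = stair m t - stair m (1 - t) + 1/2"

text \<open>The staircase equals 1/2 from 1/2 on, so on either side one of its two occurrences in
  \<open>ramp\<close> is constant. Hence \<open>ramp\<close> extends \<open>stair\<close> by point
  symmetry about (1/2, 1/2).\<close>

lemma ramp_low: "t \<le> 1/2 \<Longrightarrow> ramp m t = stair m t"
  by (simp add: ramp_def stair_half)

lemma ramp_high: "1/2 \<le> t \<Longrightarrow> ramp m t = 1 - stair m (1 - t)"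
  by (simp add: ramp_def stair_half)

lemma ramp_symmetric: "ramp m (1 - t) = 1 - ramp m t"
  by (simp add: ramp_def)

lemma ramp_mono: "s \<le> t \<Longrightarrow> ramp m s \<le> ramp m t"
  using stair_mono[of s t m] stair_mono[of "1 - t" "1 - s" m] by (simp add: ramp_def)

lemma ramp_nonpos: "t \<le> 0 \<Longrightarrow> ramp m t = 0"
  by (simp add: ramp_low stair_nonpos)

lemma ramp_one: "1 \<le> t \<Longrightarrow> ramp m t = 1"
  by (simp add: ramp_high stair_nonpos)

text \<open>If one argument is at least 1/2, symmetry reduces to subadditivity of
  \<open>stair\<close> at \<open>s\<close> and \<open>1 - (s + t)\<close>. If both are at most 1/2
  but their sum is not, the identity separates the two sides:
  \<open>ramp m (s + t) \<le> s + t\<close>, since \<open>stair\<close> lies above the identity. For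
  sums beyond 1, monotonicity and symmetry suffice.\<close>

lemma ramp_subadditive:
  assumes "0 \<le> s" "0 \<le> t"
  shows "ramp m (s + t) \<le> ramp m s + ramp m t"
proof -
  have wide: "ramp m (s + t) \<le> ramp m s + ramp m t"
    if t: "1/2 \<le> t" "s + t \<le> 1" "0 \<le> s" for s t
    using stair_subadditive[of s "1 - (s + t)" m] that
    by (cases "s \<le> 1/2") (auto simp: ramp_high ramp_low)
  consider "1 \<le> s + t" | "s + t \<le> 1/2" | "1/2 \<le> s" "s + t \<le> 1" | "1/2 \<le> t" "s + t \<le> 1"
    | "s \<le> 1/2" "t \<le> 1/2" "1/2 \<le> s + t" "s + t \<le> 1"
    by linarith
  then show ?thesis
  proof cases
    case 1
    then show ?thesis
      using ramp_mono[of "1 - s" t m] by (simp add: ramp_one ramp_symmetric)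
  next
    case 2
    then show ?thesis using assms stair_subadditive[of s t m] by (simp add: ramp_low)
  next
    case 3
    then show ?thesis using wide[of s t] assms by (simp add: add.commute)
  next
    case 4
    then show ?thesis using wide[of t s] assms by simp
  next
    case 5
    then show ?thesis
      using stair_ge[of s m] stair_ge[of t m] stair_ge[of "1 - (s + t)" m]
      by (simp add: ramp_low ramp_high)
  qed
qed

text \<open>This yields nonnegativity of the slope function: \<open>b \<le> 1/2\<close> gives
  \<open>u \<le> (u / b) / 2\<close> for \<open>0 \<le> u\<close>.\<close>

lemma ramp_ge_half: "s \<le> 1 \<Longrightarrow> s / 2 \<le> ramp m s"
  using stair_ge[of s m] stair_le_half[of m "1 - s"] stair_nonneg[of m s]
  by (cases "s \<le> 1/2") (auto simp: ramp_low ramp_high)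

section \<open>The nondecreasing transform \<open>G\<close>\<close>

definition stretched_ramp :: "real \<Rightarrow> nat \<Rightarrow> real \<Rightarrow> real" where
  "stretched_ramp b m x = of_int \<lfloor>x\<rfloor> + ramp m (frac x / b)"

lemma stretched_ramp_eq:
  assumes "of_int n \<le> x" "x < of_int n + 1"
  shows "stretched_ramp b m x = of_int n + ramp m ((x - of_int n) / b)"
proof -
  have "\<lfloor>x\<rfloor> = n" using assms by linarith
  then show ?thesis by (simp add: stretched_ramp_def frac_def)
qed

lemma stretched_ramp_add_1: "stretched_ramp b m (x + 1) = stretched_ramp b m x + 1"
  by (simp add: stretched_ramp_def frac_1_eq)

lemma stretched_ramp_0: "stretched_ramp b m 0 = 0"
  by (simp add: stretched_ramp_def ramp_nonpos)

lemma unit_interval_representative: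
  fixes x :: real
  obtains n :: int and u where "x = u + of_int n" "0 \<le> u" "u < 1"
  using that[of "frac x" "\<lfloor>x\<rfloor>"] by (simp add: frac_def) linarith

lemma stretched_ramp_add_int: "stretched_ramp b m (x + of_int n) = stretched_ramp b m x + of_int n"
  by (simp add: stretched_ramp_def frac_def)

context
  fixes b :: real and m :: nat
  assumes b: "0 < b" "b \<le> 1/2"
begin

text \<open>On \<open>[b - 1, 0)\<close> the previous period has already reached its final value,
  and \<open>-1 + 1 = 0\<close> agrees with the ramp at negative arguments. The range is wide enough
  for \<open>b - u\<close> with \<open>u\<close> in [0, 1).\<close>

lemma stretched_ramp_eq_ramp:
  assumes "b - 1 \<le> x" "x \<le> 1"
  shows "stretched_ramp b m x = ramp m (x / b)"
proof -
  have one: "ramp m (1/b) = 1" using b by (intro ramp_one) auto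
  consider "x < 0" | "0 \<le> x" "x < 1" | "x = 1" using assms by linarith
  then show ?thesis
  proof cases
    case 1
    then have "1 \<le> (x + 1) / b" "x / b \<le> 0" using assms b by (auto simp: field_simps)
    then show ?thesis using stretched_ramp_eq[of "-1" x b m] 1 assms b
      by (simp add: ramp_one ramp_nonpos)
  next
    case 2
    then show ?thesis using stretched_ramp_eq[of 0 x b m] by simp
  next
    case 3
    then show ?thesis using one by (simp add: stretched_ramp_def ramp_nonpos)
  qed
qed

lemma stretched_ramp_symmetric:
  "stretched_ramp b m x + stretched_ramp b m (b - x) = 1"
proof -
  obtain n u where u: "x = u + of_int n" "0 \<le> u" "u < 1" by (rule unit_interval_representative)
  have "stretched_ramp b m (b - x) = stretched_ramp b m (b - u) - of_int n"
    using stretched_ramp_add_int[of b m "b - u" "- n"] u by (simp add: algebra_simps)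
  also have "stretched_ramp b m (b - u) = ramp m ((b - u) / b)"
    using u b by (intro stretched_ramp_eq_ramp) auto
  also have "(b - u) / b = 1 - u / b" using b by (simp add: field_simps)
  finally show ?thesis
    using u b by (simp add: stretched_ramp_add_int stretched_ramp_eq_ramp ramp_symmetric)
qed

text \<open>Without a carry this is subadditivity of the ramp. If \<open>u + v > 1\<close>, then
  \<open>b \<le> 1/2\<close> forces one of \<open>u\<close>, \<open>v\<close> to be at least
  \<open>b\<close>; its ramp value 1 pays for the carry, and monotonicity handles the other.\<close>

lemma stretched_ramp_subadditive:
  "stretched_ramp b m (x + y) \<le> stretched_ramp b m x + stretched_ramp b m y"
proof -
  obtain n u where u: "x = u + of_int n" "0 \<le> u" "u < 1" by (rule unit_interval_representative)
  obtain k v where v: "y = v + of_int k" "0 \<le> v" "v < 1" by (rule unit_interval_representative)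
  have "stretched_ramp b m (u + v) \<le> ramp m (u / b) + ramp m (v / b)"
  proof (cases "u + v \<le> 1")
    case True
    then show ?thesis
      using ramp_subadditive[of "u/b" "v/b" m] u v b
      by (simp add: stretched_ramp_eq_ramp add_divide_distrib)
  next
    case False
    have carry: "stretched_ramp b m (u + v) = ramp m ((u + v - 1) / b) + 1"
      using stretched_ramp_add_1[of b m "u + v - 1"] u v b False
      by (simp add: stretched_ramp_eq_ramp)
    show ?thesis
    proof (cases "b \<le> u")
      case True
      then show ?thesis using carry ramp_mono[of "(u + v - 1)/b" "v/b" m] ramp_one[of "u/b" m] u b
        by (simp add: divide_right_mono)
    next
      case nu: False
      then have "b \<le> v" using False b by simp
      then show ?thesis using carry ramp_mono[of "(u + v - 1)/b" "u/b" m] ramp_one[of "v/b" m] v b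
        by (simp add: divide_right_mono)
    qed
  qed
  moreover have "x + y = u + v + of_int (n + k)" using u v by simp
  ultimately show ?thesis
    unfolding \<open>x + y = u + v + of_int (n + k)\<close> stretched_ramp_add_int
    using u v b by (simp add: stretched_ramp_add_int stretched_ramp_eq_ramp)
qed

lemma stretched_ramp_ge: "x \<le> stretched_ramp b m x"
proof -
  obtain n u where u: "x = u + of_int n" "0 \<le> u" "u < 1" by (rule unit_interval_representative)
  have "u \<le> ramp m (u / b)"
  proof (cases "b \<le> u")
    case True then show ?thesis using u b by (simp add: ramp_one)
  next
    case False
    have "u * (2 * b) \<le> u * 1" using u b by (intro mult_left_mono) auto
    then have "u \<le> u / b / 2" using b by (simp add: field_simps)
    also have "\<dots> \<le> ramp m (u / b)" using False b by (intro ramp_ge_half) auto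
    finally show ?thesis .
  qed
  then show ?thesis using u b by (simp add: stretched_ramp_add_int stretched_ramp_eq_ramp)
qed

text \<open>Here \<open>\<theta>\<close> is the transform of a competitor. It is determined on the
  flat first, then on \<open>[0, b/2]\<close> by \<open>stair_rigid\<close>, on
  \<open>[b/2, b]\<close> by symmetry, and elsewhere by periodicity.\<close>

lemma stretched_ramp_rigid:
  fixes \<theta> :: "real \<Rightarrow> real"
  assumes ge: "\<And>x. x \<le> \<theta> x" and zero: "\<theta> 0 = 0"
    and per: "\<And>x. \<theta> (x + 1) = \<theta> x + 1" and sym: "\<And>x. \<theta> x + \<theta> (b - x) = 1"
    and add: "\<And>x y. stretched_ramp b m (x + y) = stretched_ramp b m x + stretched_ramp b m y \<Longrightarrow>
        \<theta> (x + y) = \<theta> x + \<theta> y"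
  shows "\<theta> = stretched_ramp b m"
proof -
  let ?G = "stretched_ramp b m"
  have Gflat: "?G (- x) = 0" if "0 \<le> x" "x \<le> 1 - b" for x
    using that b by (simp add: stretched_ramp_eq_ramp ramp_nonpos)
  \<comment> \<open>All sums inside the flat are additive for \<open>G\<close>, so
    \<open>\<theta>\<close> is linear there; it vanishes at the far end because
    \<open>\<theta> (b - 1) = \<theta> b - 1 = 0\<close>.\<close>
  have flat: "\<theta> (- x) = 0" if x: "0 \<le> x" "x \<le> 1 - b" for x
  proof -
    have "\<theta> (- x) = \<theta> (- (1 - b)) / (1 - b) * x"
    proof (rule interval_additive_linear[where a = 0 and M = "-1"])
      fix x y :: real assume xy: "0 \<le> x" "0 \<le> y" "x + y \<le> 1 - b"
      then have "?G (- x + - y) = ?G (- x) + ?G (- y)"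
        using Gflat[of x] Gflat[of y] Gflat[of "x + y"] by simp
      from add[OF this] show "\<theta> (- (x + y)) = \<theta> (- x) + \<theta> (- y)" by simp
    next
      fix x :: real assume "0 \<le> x" "x \<le> 1 - b"
      then show "- 1 \<le> \<theta> (- x)" using ge[of "- x"] b by simp
    qed (use that b in auto)
    moreover have "\<theta> (- (1 - b)) = 0" using per[of "b - 1"] sym[of 0] zero by simp
    ultimately show ?thesis by simp
  qed
  have "\<exists>\<alpha>. \<forall>t\<in>{0..1/2}. \<theta> (b * t) = \<alpha> * stair m t"
  proof (rule stair_rigid)
    have Gs: "?G (b * t) = stair m t" if "0 \<le> t" "t \<le> 1/2" for t
    proof -
      have "b * t \<le> 1 * 1" using that b by (intro mult_mono) auto
      moreover have "b - 1 \<le> b * t" using that b mult_nonneg_nonneg[of b t] by linarith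
      ultimately show ?thesis using that b by (simp add: stretched_ramp_eq_ramp ramp_low)
    qed
    fix s t :: real
    show "\<theta> (b * (s + t)) = \<theta> (b * s) + \<theta> (b * t)"
      if "0 \<le> s" "0 \<le> t" "s + t \<le> 1/2" "stair m (s + t) = stair m s + stair m t"
      using add[of "b * s" "b * t"] Gs[of s] Gs[of t] Gs[of "s + t"] that
      by (simp add: distrib_left)
    show "\<theta> (b * s) = \<theta> (b * t)"
      if st: "0 \<le> s" "s \<le> t" "t \<le> 1/2" "stair m s = stair m t"
    proof -
      \<comment> \<open>The difference \<open>b * t - b * s\<close> fits into the flat, where
        \<open>G\<close> and \<open>\<theta>\<close> vanish. Stepping back by it from
        \<open>b * t\<close> is therefore an additivity relation of \<open>G\<close>.\<close>
      have "b * (t - s) \<le> 1/2 * (1/2)" using st b by (intro mult_mono) auto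
      then have *: "0 \<le> b * t - b * s" "b * t - b * s \<le> 1 - b"
        using st b by (auto simp: algebra_simps mult_left_mono)
      have "\<theta> (b * t + - (b * t - b * s)) = \<theta> (b * t) + \<theta> (- (b * t - b * s))"
        by (rule add) (use Gs[of s] Gs[of t] Gflat[OF *] st in simp)
      then show ?thesis using flat[OF *] by simp
    qed
    show "0 \<le> \<theta> (b * t)" if "0 \<le> t" "t \<le> 1/2" using ge[of "b * t"] that b
      by (meson less_eq_real_def mult_nonneg_nonneg order_trans)
  qed
  then obtain \<alpha> where \<alpha>: "\<And>t. 0 \<le> t \<Longrightarrow> t \<le> 1/2 \<Longrightarrow> \<theta> (b * t) = \<alpha> * stair m t"
    by (meson atLeastAtMost_iff)
  \<comment> \<open>Symmetry at the fixed point \<open>b/2\<close> gives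
    \<open>\<theta> (b/2) = 1/2\<close>.\<close>
  have "\<alpha> = 1" using \<alpha>[of "1/2"] sym[of "b/2"] by (simp add: stair_half)
  then have low: "\<theta> x = ?G x" if "0 \<le> x" "x \<le> b/2" for x
    using \<alpha>[of "x/b"] that b by (simp add: stretched_ramp_eq_ramp ramp_low field_simps)
  have unit: "\<theta> x = ?G x" if x: "0 \<le> x" "x < 1" for x
  proof -
    consider "x \<le> b/2" | "b/2 \<le> x" "x \<le> b" | "b \<le> x" by linarith
    then show ?thesis
    proof cases
      case 1 then show ?thesis using low x by simp
    next
      case 2
      then show ?thesis using low[of "b - x"] sym[of x] stretched_ramp_symmetric[of x] by simp
    next
      case 3
      then show ?thesis
        using flat[of "1 - x"] Gflat[of "1 - x"] per[of "x - 1"] stretched_ramp_add_1[of b m "x - 1"] x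
        by simp
    qed
  qed
  show ?thesis
  proof
    fix x :: real
    obtain n u where u: "x = u + of_int n" "0 \<le> u" "u < 1" by (rule unit_interval_representative)
    have "\<theta> (u + of_int n) - (u + of_int n) = \<theta> u - u"
      by (rule periodic_add_Ints[of "\<lambda>x. \<theta> x - x"]) (auto simp: per)
    then show "\<theta> x = ?G x" using u unit[of u] by (simp add: stretched_ramp_add_int)
  qed
qed

end

section \<open>The slope function and its facet conditions\<close>

definition slope_function :: "real \<Rightarrow> nat \<Rightarrow> real \<Rightarrow> real" where
  "slope_function b m x = (stretched_ramp b m x - x) / (1 - b)"

text \<open>Everything is transported through \<open>G x = (1 - b) * \<pi> x + x\<close>. The
  summand \<open>x\<close> is additive and \<open>1 - b > 0\<close>, so additivity and subadditivity
  are unaffected, while nonnegativity becomes \<open>x \<le> G x\<close>.\<close>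

lemma slope_function_facet_conditions:
  assumes b: "0 < b" "b \<le> 1/2"
  shows symmetric_periodic_slope_function: "symmetric_periodic b (slope_function b m)"
    and subadditive_slope_function:
      "slope_function b m (x + y) \<le> slope_function b m x + slope_function b m y"
    and additively_rigid_slope_function: "additively_rigid b (slope_function b m)"
proof -
  let ?G = "stretched_ramp b m"
  have nz: "1 - b > 0" using b by simp
  show "symmetric_periodic b (slope_function b m)"
    unfolding symmetric_periodic_def
  proof (intro conjI allI)
    fix x
    show "0 \<le> slope_function b m x" "slope_function b m 0 = 0"
      "slope_function b m (x + 1) = slope_function b m x"
      using stretched_ramp_ge[OF b, of x m] stretched_ramp_0[of b m] nz
      by (simp_all add: slope_function_def stretched_ramp_add_1)
    show "slope_function b m x + slope_function b m (b - x) = 1"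
      using stretched_ramp_symmetric[OF b, of m x] nz
      by (simp add: slope_function_def add_divide_distrib[symmetric])
  qed
  show "slope_function b m (x + y) \<le> slope_function b m x + slope_function b m y"
    using stretched_ramp_subadditive[OF b, of m x y] nz
    by (simp add: slope_function_def add_divide_distrib[symmetric] divide_right_mono)
  show "additively_rigid b (slope_function b m)"
    unfolding additively_rigid_def
  proof (intro allI impI)
    fix \<rho> assume sp: "symmetric_periodic b \<rho>"
      and add: "\<forall>x y. slope_function b m (x + y) = slope_function b m x + slope_function b m y
        \<longrightarrow> \<rho> (x + y) = \<rho> x + \<rho> y"
    define \<theta> where "\<theta> x = (1 - b) * \<rho> x + x" for x
    have "\<theta> = ?G"
    proof (rule stretched_ramp_rigid[OF b])
      show "x \<le> \<theta> x" for x using sp nz by (simp add: \<theta>_def symmetric_periodic_def)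
      show "\<theta> 0 = 0" using sp by (simp add: \<theta>_def symmetric_periodic_def)
      show "\<theta> (x + 1) = \<theta> x + 1" for x using sp by (simp add: \<theta>_def symmetric_periodic_def)
      show "\<theta> x + \<theta> (b - x) = 1" for x
      proof -
        have "\<rho> x + \<rho> (b - x) = 1" using sp by (simp add: symmetric_periodic_def)
        then have "(1 - b) * \<rho> x + (1 - b) * \<rho> (b - x) = 1 - b"
          by (metis distrib_left mult.right_neutral)
        then show ?thesis by (simp add: \<theta>_def algebra_simps)
      qed
      show "\<theta> (x + y) = \<theta> x + \<theta> y" if "?G (x + y) = ?G x + ?G y" for x y
      proof -
        have "\<rho> (x + y) = \<rho> x + \<rho> y"
          using that
          by (intro add[rule_format]) (simp add: slope_function_def add_divide_distrib[symmetric])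
        then show ?thesis by (simp add: \<theta>_def algebra_simps)
      qed
    qed
    then have "?G x = (1 - b) * \<rho> x + x" for x by (metis \<theta>_def)
    then show "\<rho> = slope_function b m" using nz by (auto simp: slope_function_def)
  qed
qed

subsection \<open>Piecewise affine functions of one variable\<close>

text \<open>Sets of breakpoints: local finiteness provides neighbours, and unboundedness on both
  sides makes all cells bounded.\<close>

definition unbounded_discrete :: "real set \<Rightarrow> bool" where
  "unbounded_discrete D \<longleftrightarrow>
     (\<forall>r. finite (D \<inter> {- r..r})) \<and> (\<forall>x. \<exists>d\<in>D. d < x) \<and> (\<forall>x. \<exists>d\<in>D. x < d)"

text \<open>Singletons and the empty set are included to close the collection under
  intersection.\<close>

definition interval_cells :: "real set \<Rightarrow> real set set" where
  "interval_cells D =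
     {{}} \<union> (\<lambda>d. {d}) ` D \<union> {{c..d} | c d. c \<in> D \<and> d \<in> D \<and> c < d \<and> {c<..<d} \<inter> D = {}}"

lemma unbounded_discrete_finite:
  assumes "unbounded_discrete D"
  shows "finite (D \<inter> {a..b})"
proof (rule finite_subset)
  show "D \<inter> {a..b} \<subseteq> D \<inter> {- max \<bar>a\<bar> \<bar>b\<bar>..max \<bar>a\<bar> \<bar>b\<bar>}" by auto
  show "finite (D \<inter> {- max \<bar>a\<bar> \<bar>b\<bar>..max \<bar>a\<bar> \<bar>b\<bar>})"
    using assms unfolding unbounded_discrete_def by blast
qed

lemma unbounded_discrete_next:
  assumes "unbounded_discrete D"
  obtains d where "d \<in> D" "x < d" "{x<..<d} \<inter> D = {}"
proof -
  obtain e where e: "e \<in> D" "x < e" using assms unfolding unbounded_discrete_def by blast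
  let ?E = "{y \<in> D \<inter> {x..e}. x < y}"
  have fin: "finite ?E"
    by (rule finite_subset[OF _ unbounded_discrete_finite[OF assms, of x e]]) auto
  have "e \<in> ?E" using e by simp
  then have "Min ?E \<in> ?E" using Min_in[OF fin] by blast
  moreover have "y \<notin> D" if "x < y" "y < Min ?E" for y
    using that Min_le[OF fin, of y] Min_le[OF fin \<open>e \<in> ?E\<close>] by force
  ultimately show ?thesis by (intro that[of "Min ?E"]) auto
qed

lemma unbounded_discrete_reflect:
  assumes "unbounded_discrete D"
  shows "unbounded_discrete (uminus ` D)"
  unfolding unbounded_discrete_def
proof (intro conjI allI)
  fix r x :: real
  have "uminus ` D \<inter> {- r..r} = uminus ` (D \<inter> {- r..r})" by force
  then show "finite (uminus ` D \<inter> {- r..r})"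
    using unbounded_discrete_finite[OF assms] by simp
  have "\<exists>d\<in>D. - x < d" "\<exists>d\<in>D. d < - x" using assms by (auto simp: unbounded_discrete_def)
  then show "\<exists>d\<in>uminus ` D. d < x" "\<exists>d\<in>uminus ` D. x < d" by force+
qed

lemma unbounded_discrete_prev:
  assumes "unbounded_discrete D"
  obtains d where "d \<in> D" "d < x" "{d<..<x} \<inter> D = {}"
proof -
  obtain d where d: "d \<in> uminus ` D" "- x < d" "{- x<..<d} \<inter> uminus ` D = {}"
    using unbounded_discrete_next[OF unbounded_discrete_reflect[OF assms]] .
  have "y \<notin> D" if "- d < y" "y < x" for y
  proof
    assume "y \<in> D"
    then have "- y \<in> {- x<..<d} \<inter> uminus ` D" using that by auto
    then show False using d(3) by blast
  qed
  then show ?thesis using d(1,2) by (intro that[of "- d"]) auto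
qed

lemma endpoint_face_of_interval:
  fixes c d :: real
  assumes "c \<le> d"
  shows "{c} face_of {c..d}" "{d} face_of {c..d}"
  using assms
  by (auto simp: face_of_singleton extreme_point_of_def open_segment_eq_real_ivl split: if_splits)

text \<open>No endpoint of a cell lies inside another cell, so distinct intervals meet at most in an
  endpoint. The face property for \<open>Q\<close> follows by exchanging the cells.\<close>

lemma interval_cells_Int:
  assumes P: "P \<in> interval_cells D" and Q: "Q \<in> interval_cells D"
  shows "P \<inter> Q face_of P \<and> P \<inter> Q \<in> interval_cells D"
proof -
  have empty: "{} \<in> interval_cells D" and single: "d \<in> D \<Longrightarrow> {d} \<in> interval_cells D" for d
    by (auto simp: interval_cells_def)
  consider "P = {}" | p where "P = {p}" "p \<in> D"
    | c d where "P = {c..d}" "c \<in> D" "d \<in> D" "c < d" "{c<..<d} \<inter> D = {}"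
    using P by (auto simp: interval_cells_def)
  then show ?thesis
  proof cases
    case 1 then show ?thesis using empty by simp
  next
    case 2
    then have "P \<inter> Q = {} \<or> P \<inter> Q = P" by auto
    then show ?thesis
      using P empty 2(1) by (elim disjE) (simp_all add: face_of_refl del: Int_insert_left)
  next
    case (3 c d)
    have out: "e \<le> c \<or> d \<le> e" if "e \<in> D" for e
      using 3(5) that by (metis disjoint_iff greaterThanLessThan_iff not_le)
    have "P \<inter> Q \<in> {{}, {c}, {d}, P}"
    proof -
      consider "Q = {}" | q where "Q = {q}" "q \<in> D"
        | c' d' where "Q = {c'..d'}" "c' \<in> D" "d' \<in> D" "c' < d'" "{c'<..<d'} \<inter> D = {}"
        using Q by (auto simp: interval_cells_def)
      then show ?thesis
      proof cases
        case (2 q) then show ?thesis using out[of q] 3(1,4) by auto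
      next
        case (3 c' d')
        have out': "e \<le> c' \<or> d' \<le> e" if "e \<in> D" for e
          using 3(5) that by (metis disjoint_iff greaterThanLessThan_iff not_le)
        consider "c' = c" "d' = d" | "d \<le> c'" | "d' \<le> c"
          using out[of c'] out[of d'] out'[of c] out'[of d] 3(2-4) \<open>c < d\<close> \<open>c \<in> D\<close> \<open>d \<in> D\<close> by linarith
        then show ?thesis
          using 3(1,4) \<open>P = {c..d}\<close> \<open>c < d\<close> by cases auto
      qed simp
    qed
    then consider "P \<inter> Q = {}" | "P \<inter> Q = {c}" | "P \<inter> Q = {d}" | "P \<inter> Q = P" by blast
    then show ?thesis
      using P 3(1-4) empty single endpoint_face_of_interval[of c d]
      by cases (simp_all add: face_of_refl)
  qed
qed

lemma regular_polyhedral_complex_interval_cells: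
  assumes D: "unbounded_discrete D"
  shows "regular_polyhedral_complex (interval_cells D)"
  unfolding regular_polyhedral_complex_def
proof (intro conjI ballI allI impI)
  fix P assume "P \<in> interval_cells D"
  then have "P = {} \<or> (\<exists>c d. P = {c..d})"
    by (auto simp: interval_cells_def) (metis atLeastAtMost_singleton)+
  then show "polyhedron P" 
    by (metis box_real(2) polyhedron_empty polyhedron_interval)
next
  have "x \<in> \<Union>(interval_cells D)" for x
  proof (cases "x \<in> D")
    case True then show ?thesis by (auto simp: interval_cells_def)
  next
    case False
    obtain d where d: "d \<in> D" "x < d" "{x<..<d} \<inter> D = {}" using unbounded_discrete_next[OF D] .
    obtain c where c: "c \<in> D" "c < x" "{c<..<x} \<inter> D = {}" using unbounded_discrete_prev[OF D] .
    have "y \<notin> D" if "y \<in> {c<..<d}" for y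
      using c(3) d(3) False that by (cases y x rule: linorder_cases) (auto simp: disjoint_iff)
    then have "{c<..<d} \<inter> D = {}" by blast
    then have "{c..d} \<in> interval_cells D" using c d by (auto simp: interval_cells_def)
    then show ?thesis using c d by (intro UnionI[of "{c..d}"]) auto
  qed
  then show "\<Union>(interval_cells D) = UNIV" by blast
next
  fix P Q assume PQ: "P \<in> interval_cells D" "Q \<in> interval_cells D"
  show "P \<inter> Q face_of P" "P \<inter> Q \<in> interval_cells D" using interval_cells_Int[OF PQ] by auto
  show "P \<inter> Q face_of Q" using interval_cells_Int[OF PQ(2,1)] by (simp add: Int_commute)
next
  fix B :: "real set" assume "bounded B"
  then obtain r where r: "\<And>x. x \<in> B \<Longrightarrow> \<bar>x\<bar> \<le> r" by (auto simp: bounded_iff)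
  \<comment> \<open>The breakpoints \<open>a\<close> and \<open>e\<close> enclose \<open>B\<close>
    strictly and lie inside no cell, so a cell meeting \<open>B\<close> has its endpoints in the
    finite set \<open>D \<inter> {a..e}\<close>.\<close>
  obtain a where a: "a \<in> D" "a < - r" using D unfolding unbounded_discrete_def by blast
  obtain e where e: "e \<in> D" "r < e" using D unfolding unbounded_discrete_def by blast
  let ?E = "D \<inter> {a..e}"
  have "{P \<in> interval_cells D. P \<inter> B \<noteq> {}} \<subseteq>
      (\<lambda>d. {d}) ` ?E \<union> (\<lambda>(c, d). {c..d}) ` (?E \<times> ?E)"
  proof
    fix P assume P: "P \<in> {P \<in> interval_cells D. P \<inter> B \<noteq> {}}"
    then obtain x where x: "x \<in> P" "x \<in> B" by auto
    have xr: "a < x" "x < e" using r[OF x(2)] a e by auto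
    consider "P = {x}" "x \<in> D"
      | c d where "P = {c..d}" "c \<in> D" "d \<in> D" "c < d" "{c<..<d} \<inter> D = {}"
      using P x(1) by (auto simp: interval_cells_def)
    then show "P \<in> (\<lambda>d. {d}) ` ?E \<union> (\<lambda>(c, d). {c..d}) ` (?E \<times> ?E)"
    proof cases
      case (2 c d)
      have "a \<notin> {c<..<d}" "e \<notin> {c<..<d}" using 2(5) a e by blast+
      then have "c \<in> ?E" "d \<in> ?E" using 2 x(1) xr by auto
      then show ?thesis using 2(1) by auto
    qed (use xr in auto)
  qed
  moreover have "finite ?E" using unbounded_discrete_finite[OF D] .
  ultimately show "finite {P \<in> interval_cells D. P \<inter> B \<noteq> {}}"
    by (meson finite_SigmaI finite_UnI finite_imageI finite_subset)
qed

section \<open>Slope sets of piecewise affine functions\<close>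

definition affine_pieces :: "real set \<Rightarrow> real set \<Rightarrow> (real \<Rightarrow> real) \<Rightarrow> bool" where
  "affine_pieces D S f \<longleftrightarrow>
     (\<forall>c d. c < d \<longrightarrow> {c<..<d} \<inter> D = {} \<longrightarrow> (\<exists>s\<in>S. \<exists>e. \<forall>x\<in>{c<..<d}. f x = s * x + e))"

text \<open>While \<open>affine_pieces\<close> bounds the set of slopes from above, this bounds it
  from below.\<close>

definition attains_slopes :: "real set \<Rightarrow> (real \<Rightarrow> real) \<Rightarrow> bool" where
  "attains_slopes S f \<longleftrightarrow> (\<forall>s\<in>S. \<exists>c d e. c < d \<and> (\<forall>x\<in>{c<..<d}. f x = s * x + e))"

lemma affine_piecesD:
  assumes "affine_pieces D S f" "c < d" "\<And>x. c < x \<Longrightarrow> x < d \<Longrightarrow> x \<notin> D"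
  obtains s e where "s \<in> S" "\<And>x. c < x \<Longrightarrow> x < d \<Longrightarrow> f x = s * x + e"
proof -
  have "{c<..<d} \<inter> D = {}" using assms(3) by auto
  then show ?thesis
    using assms(1,2) that unfolding affine_pieces_def by (metis greaterThanLessThan_iff)
qed

lemma affine_piecesI:
  assumes "\<And>c d. c < d \<Longrightarrow> (\<And>x. c < x \<Longrightarrow> x < d \<Longrightarrow> x \<notin> D) \<Longrightarrow>
     \<exists>s\<in>S. \<exists>e. \<forall>x. c < x \<longrightarrow> x < d \<longrightarrow> f x = s * x + e"
  shows "affine_pieces D S f"
  unfolding affine_pieces_def
proof (intro allI impI)
  fix c d :: real assume "c < d" "{c<..<d} \<inter> D = {}"
  then have "\<exists>s\<in>S. \<exists>e. \<forall>x. c < x \<longrightarrow> x < d \<longrightarrow> f x = s * x + e"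
    by (intro assms) (auto simp: disjoint_iff)
  then show "\<exists>s\<in>S. \<exists>e. \<forall>x\<in>{c<..<d}. f x = s * x + e"
    by (metis greaterThanLessThan_iff)
qed

lemma piecewise_linear_affine_pieces:
  assumes D: "unbounded_discrete D" and f: "affine_pieces D S f"
  shows "piecewise_linear f"
  unfolding piecewise_linear_def
proof (intro exI conjI ballI)
  show "regular_polyhedral_complex (interval_cells D)"
    by (rule regular_polyhedral_complex_interval_cells[OF D])
  fix P assume "P \<in> interval_cells D"
  then consider "interior P = {}" | c d where "interior P = {c<..<d}" "c < d" "{c<..<d} \<inter> D = {}"
    by (auto simp: interval_cells_def interior_atLeastAtMost_real)
  then show "affine_over (interior P) f"
  proof cases
    case (2 c d)
    then obtain s e where "\<forall>x\<in>{c<..<d}. f x = s * x + e" using f unfolding affine_pieces_def by meson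
    then show ?thesis using 2(1) by (auto simp: affine_over_def)
  qed (simp add: affine_over_def)
qed

lemma gderiv_real_iff: "GDERIV f x :> g \<longleftrightarrow> (f has_real_derivative g) (at x)" for f :: "real \<Rightarrow> real"
  by (simp add: gderiv_def has_field_derivative_def mult.commute[of g] fun_eq_iff)

text \<open>The point \<open>x\<close> may be a breakpoint at which \<open>f\<close> happens to be
  differentiable. Continuity then places \<open>f x\<close> on the line to its right, and the
  one-sided derivative is unique.\<close>

lemma derivative_eq_right_slope:
  fixes f :: "real \<Rightarrow> real"
  assumes der: "(f has_real_derivative g) (at x)" and "x < d"
    and f: "\<And>y. x < y \<Longrightarrow> y < d \<Longrightarrow> f y = s * y + e"
  shows "g = s"
proof -
  have ev: "\<forall>\<^sub>F y in at_right x. f y = s * y + e"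
    using f \<open>x < d\<close> eventually_at_right[of x] by blast
  have "(f \<longlongrightarrow> f x) (at_right x)"
    using DERIV_isCont[OF der] by (simp add: isCont_def filterlim_at_split)
  moreover have "(f \<longlongrightarrow> s * x + e) (at_right x)"
    unfolding tendsto_cong[OF ev] by (intro tendsto_intros)
  ultimately have fx: "f x = s * x + e" using tendsto_unique[of "at_right x"] by simp
  have "((\<lambda>y. s * y + e) has_real_derivative g) (at x within {x..})"
    by (rule has_field_derivative_transform_within[where f = f and d = "d - x"])
       (use der f fx \<open>x < d\<close> in \<open>auto simp: dist_real_def le_less intro: DERIV_subset\<close>)
  moreover have "((\<lambda>y. s * y + e) has_real_derivative s) (at x within {x..})"
    by (auto intro!: derivative_eq_intros)
  ultimately show ?thesis
    by (rule has_field_derivative_unique) (simp add: at_within_Ici_at_right)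
qed

lemma has_slopes_affine_pieces:
  assumes D: "unbounded_discrete D" and f: "affine_pieces D S f"
    and att: "attains_slopes S f" and "finite S"
  shows "has_slopes f (card S)"
proof -
  have "{g. \<exists>x. GDERIV f x :> g} = S"
  proof (intro equalityI subsetI)
    fix g assume "g \<in> {g. \<exists>x. GDERIV f x :> g}"
    then obtain x where x: "(f has_real_derivative g) (at x)" by (auto simp: gderiv_real_iff)
    obtain d where d: "d \<in> D" "x < d" "{x<..<d} \<inter> D = {}" using unbounded_discrete_next[OF D] .
    then obtain s e where "s \<in> S" "\<forall>y\<in>{x<..<d}. f y = s * y + e"
      using f unfolding affine_pieces_def by meson
    then show "g \<in> S" using derivative_eq_right_slope[OF x d(2), of s e] by auto
  next
    fix s assume "s \<in> S"
    then obtain c d e where cd: "c < d" "\<forall>x\<in>{c<..<d}. f x = s * x + e"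
      using att unfolding attains_slopes_def by meson
    have "((\<lambda>x. s * x + e) has_real_derivative s) (at ((c + d) / 2))"
      by (auto intro!: derivative_eq_intros)
    then have "(f has_real_derivative s) (at ((c + d) / 2))"
      by (rule has_field_derivative_transform_within_open[where S = "{c<..<d}"]) (use cd in auto)
    then show "s \<in> {g. \<exists>x. GDERIV f x :> g}" by (auto simp: gderiv_real_iff)
  qed
  then show ?thesis using \<open>finite S\<close> by (simp add: has_slopes_def)
qed

lemma affine_pieces_reflect:
  assumes "affine_pieces D S f"
  shows "affine_pieces (uminus ` D) (uminus ` S) (\<lambda>x. f (- x))"
proof (rule affine_piecesI)
  fix c d :: real assume cd: "c < d" and out: "\<And>x. c < x \<Longrightarrow> x < d \<Longrightarrow> x \<notin> uminus ` D"
  obtain s e where s: "s \<in> S" "\<And>x. - d < x \<Longrightarrow> x < - c \<Longrightarrow> f x = s * x + e"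
  proof (rule affine_piecesD[OF assms])
    show "x \<notin> D" if "- d < x" "x < - c" for x using out[of "- x"] that by auto
  qed (use cd in auto)
  then show "\<exists>s\<in>uminus ` S. \<exists>e. \<forall>x. c < x \<longrightarrow> x < d \<longrightarrow> f (- x) = s * x + e"
    by (intro bexI[of _ "- s"] exI[of _ e]) auto
qed

lemma attains_slopes_reflect:
  assumes "attains_slopes S f"
  shows "attains_slopes (uminus ` S) (\<lambda>x. f (- x))"
  unfolding attains_slopes_def
proof
  fix s assume "s \<in> uminus ` S"
  then obtain c d e where "c < d" "\<forall>x\<in>{c<..<d}. f x = - s * x + e"
    using assms unfolding attains_slopes_def by fastforce
  then show "\<exists>c d e. c < d \<and> (\<forall>x\<in>{c<..<d}. f (- x) = s * x + e)"
    by (intro exI[of _ "- d"] exI[of _ "- c"] exI[of _ e]) auto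
qed

subsection \<open>The slopes of the staircase function\<close>

text \<open>The flat of the outermost level ends at 1/8; its start 1/16 is the rescaled 1/2.\<close>

primrec stair_breaks :: "nat \<Rightarrow> real set" where
  "stair_breaks 0 = {0, 1/2}"
| "stair_breaks (Suc m) = {0, 1/8, 1/2} \<union> (\<lambda>t. t / 8) ` stair_breaks m"

definition stair_slopes :: "nat \<Rightarrow> real set" where
  "stair_slopes m = insert 0 ((\<lambda>j. 2 ^ j) ` {..m})"

lemma finite_stair_breaks: "finite (stair_breaks m)"
  by (induction m) auto

lemma stair_breaks_bounds: "stair_breaks m \<subseteq> {0..1/2}"
  by (induction m) (auto simp: subset_iff)

lemma endpoints_in_stair_breaks: "0 \<in> stair_breaks m" "1/2 \<in> stair_breaks m"
  by (cases m; simp)+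

lemma stair_slopes_Suc: "s \<in> stair_slopes m \<Longrightarrow> 2 * s \<in> stair_slopes (Suc m)"
  by (force simp: stair_slopes_def image_iff simp flip: power_Suc)

text \<open>The slope set belongs to an arbitrary level \<open>m\<close>, so that the outer branch
  can be reused in the induction below.\<close>

lemma affine_pieces_stair_0:
  assumes "c < d" "\<And>x. c < x \<Longrightarrow> x < d \<Longrightarrow> x \<notin> {0, 1/2}"
  shows "\<exists>s\<in>stair_slopes m. \<exists>e. \<forall>x. c < x \<longrightarrow> x < d \<longrightarrow> stair 0 x = s * x + e"
proof -
  have "d \<le> t \<or> t \<le> c" if "t \<in> {0, 1/2}" for t
    using assms(2)[of t] that by (meson not_le)
  then have "d \<le> 0 \<or> 0 \<le> c" "d \<le> 1/2 \<or> 1/2 \<le> c" by blast+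
  then consider "d \<le> 0" | "0 \<le> c" "d \<le> 1/2" | "1/2 \<le> c" by linarith
  then show ?thesis
  proof cases
    case 1 then show ?thesis by (intro bexI[of _ 0] exI[of _ 0]) (auto simp: stair_slopes_def)
  next
    case 2 then show ?thesis by (intro bexI[of _ 1] exI[of _ 0]) (auto simp: stair_slopes_def image_iff intro: bexI[of _ 0])
  next
    case 3 then show ?thesis by (intro bexI[of _ 0] exI[of _ "1/2"]) (auto simp: stair_slopes_def)
  qed
qed

text \<open>Since 1/8 is a breakpoint, each interval lies on one side of it: on the right the outer
  branch applies, on the left the rescaled copy, whose slopes are doubled by the factor 8/4.\<close>

lemma affine_pieces_stair: "affine_pieces (stair_breaks m) (stair_slopes m) (stair m)"
proof (induction m)
  case 0
  show ?case by (rule affine_piecesI, rule affine_pieces_stair_0) auto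
next
  case (Suc m)
  show ?case
  proof (rule affine_piecesI)
    fix c d :: real
    assume cd: "c < d" and out: "\<And>x. c < x \<Longrightarrow> x < d \<Longrightarrow> x \<notin> stair_breaks (Suc m)"
    consider "1/8 \<le> c" | "d \<le> 1/8" using out[of "1/8"] by fastforce
    then show "\<exists>s\<in>stair_slopes (Suc m). \<exists>e. \<forall>x. c < x \<longrightarrow> x < d \<longrightarrow> stair (Suc m) x = s * x + e"
    proof cases
      case 1
      have "\<exists>s\<in>stair_slopes (Suc m). \<exists>e. \<forall>x. c < x \<longrightarrow> x < d \<longrightarrow> stair 0 x = s * x + e"
        by (rule affine_pieces_stair_0[OF cd]) (use out in auto)
      moreover have "stair (Suc m) x = stair 0 x" if "c < x" for x
        using 1 that by (intro stair_Suc_large) simp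
      ultimately show ?thesis by metis
    next
      case 2
      obtain s e where s: "s \<in> stair_slopes m" "\<And>x. 8 * c < x \<Longrightarrow> x < 8 * d \<Longrightarrow> stair m x = s * x + e"
      proof (rule affine_piecesD[OF Suc.IH])
        show "x \<notin> stair_breaks m" if "8 * c < x" "x < 8 * d" for x using out[of "x / 8"] that by auto
      qed (use cd in auto)
      have "stair (Suc m) x = 2 * s * x + e / 4" if "c < x" "x < d" for x
        using stair_Suc_small[of x m] s(2)[of "8 * x"] 2 that by simp
      then show ?thesis using stair_slopes_Suc[OF s(1)] by blast
    qed
  qed
qed

text \<open>Slope 0 is excluded because \<open>stair 0\<close> has no flat inside [0, 1/2]; that
  slope is found beyond the ramp instead.\<close>

lemma attains_slopes_stair:
  "s \<in> stair_slopes m \<Longrightarrow> s \<noteq> 0 \<Longrightarrow>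
     \<exists>c d e. 0 \<le> c \<and> c < d \<and> d \<le> 1/2 \<and> (\<forall>t\<in>{c<..<d}. stair m t = s * t + e)"
proof (induction m arbitrary: s)
  case 0
  then have "s = 1" by (auto simp: stair_slopes_def)
  then show ?case by (intro exI[of _ 0] exI[of _ "1/2"] exI[of _ 0]) auto
next
  case (Suc m)
  then obtain j where j: "j \<le> Suc m" "s = 2 ^ j" by (auto simp: stair_slopes_def)
  show ?case
  proof (cases j)
    case 0
    have "stair (Suc m) t = s * t + 0" if "t \<in> {1/8<..<1/2}" for t
      using that j(2) 0 stair_Suc_large[of t m] by simp
    then show ?thesis by (intro exI[of _ "1/8"] exI[of _ "1/2"] exI[of _ 0]) auto
  next
    case (Suc i)
    then have "2 ^ i \<in> stair_slopes m" using j(1) by (auto simp: stair_slopes_def)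
    then obtain c d e where cd: "0 \<le> c" "c < d" "d \<le> 1/2" "\<And>t. t \<in> {c<..<d} \<Longrightarrow> stair m t = 2 ^ i * t + e"
      using Suc.IH[of "2 ^ i"] by force
    have "stair (Suc m) t = s * t + e / 4" if "t \<in> {c/8<..<d/8}" for t
      using stair_Suc_small[of t m] cd(4)[of "8 * t"] cd(3) that j(2) Suc by simp
    then show ?thesis
      using cd(1-3) by (intro exI[of _ "c/8"] exI[of _ "d/8"] exI[of _ "e/4"]) auto
  qed
qed

section \<open>Breakpoints and slopes of the slope function\<close>

definition ramp_breaks :: "nat \<Rightarrow> real set" where
  "ramp_breaks m = stair_breaks m \<union> (\<lambda>t. 1 - t) ` stair_breaks m"

lemma affine_pieces_ramp: "affine_pieces (ramp_breaks m) (stair_slopes m) (ramp m)"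
proof (rule affine_piecesI)
  fix c d :: real
  assume cd: "c < d" and out: "\<And>x. c < x \<Longrightarrow> x < d \<Longrightarrow> x \<notin> ramp_breaks m"
  have "1/2 \<in> ramp_breaks m" using endpoints_in_stair_breaks by (simp add: ramp_breaks_def)
  then consider "d \<le> 1/2" | "1/2 \<le> c" using out[of "1/2"] by force
  then show "\<exists>s\<in>stair_slopes m. \<exists>e. \<forall>x. c < x \<longrightarrow> x < d \<longrightarrow> ramp m x = s * x + e"
  proof cases
    case 1
    obtain s e where s: "s \<in> stair_slopes m" "\<And>x. c < x \<Longrightarrow> x < d \<Longrightarrow> stair m x = s * x + e"
      using affine_piecesD[OF affine_pieces_stair cd, of m] out by (auto simp: ramp_breaks_def)
    then have "ramp m x = s * x + e" if "c < x" "x < d" for x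
      using 1 that by (simp add: ramp_low)
    then show ?thesis using s(1) by blast
  next
    case 2
    obtain s e where s: "s \<in> stair_slopes m"
      "\<And>x. 1 - d < x \<Longrightarrow> x < 1 - c \<Longrightarrow> stair m x = s * x + e"
    proof (rule affine_piecesD[OF affine_pieces_stair])
      show "x \<notin> stair_breaks m" if "1 - d < x" "x < 1 - c" for x
        using out[of "1 - x"] that by (auto simp: ramp_breaks_def image_iff)
    qed (use cd in auto)
    have "ramp m x = s * x + (1 - s - e)" if "c < x" "x < d" for x
      using 2 that s(2)[of "1 - x"] by (simp add: ramp_high algebra_simps)
    then show ?thesis using s(1) by blast
  qed
qed

definition slope_function_breaks :: "real \<Rightarrow> nat \<Rightarrow> real set" where
  "slope_function_breaks b m = {of_int n + b * t | n t. t \<in> ramp_breaks m}"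

text \<open>Chain rule: slope \<open>s\<close> of the ramp becomes \<open>s / b\<close> for
  \<open>G\<close>.\<close>

definition slope_function_slopes :: "real \<Rightarrow> nat \<Rightarrow> real set" where
  "slope_function_slopes b m = (\<lambda>s. (s / b - 1) / (1 - b)) ` stair_slopes m"

context
  fixes b :: real and m :: nat
  assumes b: "0 < b" "b \<le> 1/2"
begin

lemma Ints_in_slope_function_breaks: "of_int n \<in> slope_function_breaks b m"
  using endpoints_in_stair_breaks[of m]
  by (force simp: slope_function_breaks_def ramp_breaks_def)

lemma unbounded_discrete_slope_function_breaks: "unbounded_discrete (slope_function_breaks b m)"
  unfolding unbounded_discrete_def
proof (intro conjI allI)
  fix r x :: real
  \<comment> \<open>The offset \<open>b * t\<close> lies in [0, 1], so only integers between
    \<open>- r - 1\<close> and \<open>r\<close> can occur.\<close>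
  have "slope_function_breaks b m \<inter> {- r..r}
      \<subseteq> (\<lambda>(n, t). of_int n + b * t) ` ({\<lfloor>- r - 1\<rfloor>..\<lceil>r\<rceil>} \<times> ramp_breaks m)"
  proof
    fix y assume "y \<in> slope_function_breaks b m \<inter> {- r..r}"
    then obtain n t where y: "y = of_int n + b * t" "t \<in> ramp_breaks m" "- r \<le> y" "y \<le> r"
      by (auto simp: slope_function_breaks_def)
    have "0 \<le> t" "t \<le> 1" using y(2) stair_breaks_bounds[of m] by (force simp: ramp_breaks_def)+
    then have "0 \<le> b * t" "b * t \<le> 1" using b mult_mono[of b 1 t 1] by simp_all
    then have "- r - 1 \<le> of_int n" "of_int n \<le> r" using y by auto
    then have "n \<in> {\<lfloor>- r - 1\<rfloor>..\<lceil>r\<rceil>}" by (simp add: floor_le_iff le_ceiling_iff) linarith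
    then show "y \<in> (\<lambda>(n, t). of_int n + b * t) ` ({\<lfloor>- r - 1\<rfloor>..\<lceil>r\<rceil>} \<times> ramp_breaks m)"
      using y by force
  qed
  moreover have "finite (ramp_breaks m)" by (simp add: ramp_breaks_def finite_stair_breaks)
  ultimately show "finite (slope_function_breaks b m \<inter> {- r..r})"
    by (meson finite_SigmaI finite_atLeastAtMost_int finite_imageI finite_subset)
  have "of_int (\<lfloor>x\<rfloor> - 1) < x" "x < of_int (\<lfloor>x\<rfloor> + 1)" by linarith+
  then show "\<exists>d\<in>slope_function_breaks b m. d < x" "\<exists>d\<in>slope_function_breaks b m. x < d"
    using Ints_in_slope_function_breaks by blast+
qed

lemma affine_pieces_slope_function:
  "affine_pieces (slope_function_breaks b m) (slope_function_slopes b m) (slope_function b m)"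
proof (rule affine_piecesI)
  fix c d :: real
  assume cd: "c < d" and out: "\<And>x. c < x \<Longrightarrow> x < d \<Longrightarrow> x \<notin> slope_function_breaks b m"
  \<comment> \<open>Integers are breakpoints, so the interval stays within one period, which its
    midpoint identifies.\<close>
  define n where "n = \<lfloor>(c + d) / 2\<rfloor>"
  have "of_int n \<le> (c + d) / 2" "(c + d) / 2 < of_int (n + 1)" unfolding n_def by linarith+
  then have mid: "2 * of_int n \<le> c + d" "c + d < 2 * of_int n + 2" by simp_all
  have cell: "of_int k \<le> c \<or> d \<le> of_int k" for k
    using out[of "of_int k"] Ints_in_slope_function_breaks[of k] by (meson not_le)
  have n: "of_int n \<le> c" using cell[of n] cd mid(1) by linarith
  have n': "d \<le> of_int n + 1" using cell[of "n + 1"] cd mid(2) by simp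
  have lt: "(c - of_int n) / b < (d - of_int n) / b" using cd b by (simp add: divide_strict_right_mono)
  have avoid: "t \<notin> ramp_breaks m" if "(c - of_int n) / b < t" "t < (d - of_int n) / b" for t
  proof
    assume "t \<in> ramp_breaks m"
    then have "of_int n + b * t \<in> slope_function_breaks b m" by (auto simp: slope_function_breaks_def)
    moreover have "c < of_int n + b * t" "of_int n + b * t < d" using that b by (auto simp: field_simps)
    ultimately show False using out by blast
  qed
  obtain s e where s: "s \<in> stair_slopes m"
    "\<And>t. (c - of_int n) / b < t \<Longrightarrow> t < (d - of_int n) / b \<Longrightarrow> ramp m t = s * t + e"
    using affine_piecesD[OF affine_pieces_ramp lt avoid] by metis
  have "slope_function b m x
      = (s / b - 1) / (1 - b) * x + (of_int n - s / b * of_int n + e) / (1 - b)"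
    if x: "c < x" "x < d" for x
  proof -
    have "stretched_ramp b m x = of_int n + ramp m ((x - of_int n) / b)"
      using x n n' by (intro stretched_ramp_eq) auto
    also have "ramp m ((x - of_int n) / b) = s * ((x - of_int n) / b) + e"
      using x b by (intro s(2)) (auto simp: divide_strict_right_mono)
    finally have "stretched_ramp b m x - x = (s / b - 1) * x + (of_int n - s / b * of_int n + e)"
      by (simp add: algebra_simps diff_divide_distrib)
    then show ?thesis by (simp add: slope_function_def add_divide_distrib)
  qed
  then show "\<exists>s\<in>slope_function_slopes b m. \<exists>e. \<forall>x. c < x \<longrightarrow> x < d \<longrightarrow> slope_function b m x = s * x + e"
    using s(1) unfolding slope_function_slopes_def by blast
qed

lemma attains_slopes_slope_function: "attains_slopes (slope_function_slopes b m) (slope_function b m)"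
  unfolding attains_slopes_def
proof
  fix g assume "g \<in> slope_function_slopes b m"
  then obtain s where s: "s \<in> stair_slopes m" "g = (s / b - 1) / (1 - b)"
    by (auto simp: slope_function_slopes_def)
  \<comment> \<open>The bound \<open>1/b\<close> keeps the interval inside the first period after
    scaling by \<open>b\<close>.\<close>
  have "\<exists>c d e. 0 \<le> c \<and> c < d \<and> d \<le> 1/b \<and> (\<forall>t\<in>{c<..<d}. ramp m t = s * t + e)"
  proof (cases "s = 0")
    \<comment> \<open>Slope 0 occurs between 1 and \<open>1/b\<close>, where the ramp is constantly
      1.\<close>
    case True
    then show ?thesis
      using b by (intro exI[of _ 1] exI[of _ "1/b"]) (auto simp: ramp_one)
  next
    case False
    obtain c d e where cd: "0 \<le> c" "c < d" "d \<le> 1/2" "\<forall>t\<in>{c<..<d}. stair m t = s * t + e"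
      using attains_slopes_stair[OF s(1) False] by blast
    moreover have "1/2 \<le> 1/b" using b by (simp add: field_simps)
    ultimately show ?thesis
      by (intro exI[of _ c] exI[of _ d] exI[of _ e]) (auto simp: ramp_low)
  qed
  then obtain c d e where cd: "0 \<le> c" "c < d" "d \<le> 1/b" "\<And>t. t \<in> {c<..<d} \<Longrightarrow> ramp m t = s * t + e"
    by metis
  have "slope_function b m x = g * x + e / (1 - b)" if x: "x \<in> {b * c<..<b * d}" for x
  proof -
    have "b * d \<le> 1" using cd(3) b by (simp add: field_simps)
    moreover have "0 \<le> b * c" using cd(1) b by simp
    ultimately have "stretched_ramp b m x = ramp m (x / b)"
      using stretched_ramp_eq[of 0 x b m] x by simp
    also have "\<dots> = s * (x / b) + e" using x b by (intro cd(4)) (auto simp: field_simps)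
    finally have "stretched_ramp b m x - x = (s / b - 1) * x + e"
      by (simp add: algebra_simps)
    then show ?thesis by (simp add: slope_function_def s(2) add_divide_distrib)
  qed
  moreover have "b * c < b * d" using cd(2) b by simp
  ultimately show "\<exists>c d e. c < d \<and> (\<forall>x\<in>{c<..<d}. slope_function b m x = g * x + e)" by blast
qed

lemma card_slope_function_slopes: "card (slope_function_slopes b m) = m + 2"
proof -
  have "inj_on (\<lambda>s. (s / b - 1) / (1 - b)) (stair_slopes m)"
    using b by (auto simp: inj_on_def)
  moreover have "card (stair_slopes m) = m + 2"
  proof -
    have "inj_on (\<lambda>j. 2 ^ j :: real) {..m}" by (auto simp: inj_on_def)
    then show ?thesis by (auto simp: stair_slopes_def card_insert_if card_image)
  qed
  ultimately show ?thesis by (simp add: slope_function_slopes_def card_image)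
qed

lemma finite_slope_function_slopes: "finite (slope_function_slopes b m)"
  by (simp add: slope_function_slopes_def stair_slopes_def)

end

section \<open>Assembly for an arbitrary non-integer \<open>b\<close>\<close>

theorem theorem1p3:
  fixes b :: real and k :: nat
  assumes "b \<notin> \<int>" and "k \<ge> 2"
  shows "\<exists>\<pi> :: real \<Rightarrow> real.
           facet_function b \<pi> \<and> extreme_function b \<pi> \<and> piecewise_linear \<pi> \<and> has_slopes \<pi> k"
proof -
  \<comment> \<open>Level \<open>m\<close> has the slope 0 and \<open>m + 1\<close> powers of
    two.\<close>
  define m where "m = k - 2"
  have m: "m + 2 = k" using assms(2) by (simp add: m_def)
  have "frac b \<noteq> 0" using assms(1) by simp
  then have frac: "0 < frac b" "frac b < 1" using frac_ge_0[of b] frac_lt_1[of b] by auto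
  have "\<exists>\<pi>. facet_function b \<pi> \<and> piecewise_linear \<pi> \<and> has_slopes \<pi> k"
  proof (cases "frac b \<le> 1/2")
    case True
    let ?\<pi> = "slope_function (frac b) m"
    note fb = frac(1) True
    have "b - frac b \<in> \<int>" by (simp add: frac_def)
    then have "facet_function b ?\<pi>"
      using slope_function_facet_conditions[OF fb]
        symmetric_periodic_cong_Ints additively_rigid_cong_Ints facet_functionI by metis
    moreover have "piecewise_linear ?\<pi>"
      using piecewise_linear_affine_pieces unbounded_discrete_slope_function_breaks[OF fb]
        affine_pieces_slope_function[OF fb] by blast
    moreover have "has_slopes ?\<pi> k"
      using has_slopes_affine_pieces[OF unbounded_discrete_slope_function_breaks[OF fb]
          affine_pieces_slope_function[OF fb] attains_slopes_slope_function[OF fb]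
          finite_slope_function_slopes[OF fb], of m]
      unfolding card_slope_function_slopes[OF fb] m .
    ultimately show ?thesis by blast
  next
    case False
    \<comment> \<open>Modulo the integers \<open>b\<close> equals \<open>- c\<close>, and
      \<open>c < 1/2\<close>, so the reflected slope function for \<open>c\<close> serves
      \<open>b\<close>.\<close>
    define c where "c = 1 - frac b"
    let ?\<pi> = "\<lambda>x. slope_function c m (- x)"
    have c: "0 < c" "c \<le> 1/2" using frac False by (auto simp: c_def)
    have "b - (- c) = of_int (\<lfloor>b\<rfloor> + 1)" by (simp add: c_def frac_def)
    then have "b - (- c) \<in> \<int>" by (metis Ints_of_int)
    moreover have "?\<pi> (x + y) \<le> ?\<pi> x + ?\<pi> y" for x y
      using subadditive_slope_function[OF c, of m "- x" "- y"] by (simp add: add.commute)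
    ultimately have "facet_function b ?\<pi>"
      using symmetric_periodic_reflect[OF symmetric_periodic_slope_function[OF c]]
        additively_rigid_reflect[OF additively_rigid_slope_function[OF c]]
        symmetric_periodic_cong_Ints additively_rigid_cong_Ints
      by (intro facet_functionI) blast+
    note D = unbounded_discrete_reflect[OF unbounded_discrete_slope_function_breaks[OF c]]
    note P = affine_pieces_reflect[OF affine_pieces_slope_function[OF c]]
    note A = attains_slopes_reflect[OF attains_slopes_slope_function[OF c]]
    have "piecewise_linear ?\<pi>" using piecewise_linear_affine_pieces[OF D P] .
    moreover have "has_slopes ?\<pi> k"
      using has_slopes_affine_pieces[OF D P A, of m] finite_slope_function_slopes[OF c, of m]
        card_slope_function_slopes[OF c, of m] m
      by (simp add: card_image)
    ultimately show ?thesis using \<open>facet_function b ?\<pi>\<close> by blast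
  qed
  then show ?thesis using facet_imp_extreme by blast
qed

end
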